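(* Let $\mathcal{K}\subset\mathbb{R}^d$ be a compact convex set, symmetric about the origin, let $\zeta$ be uniformly distributed on $\mathcal{K}$, let $\mathcal{X}\subset\mathbb{R}^n$ be closed, convex and bounded, and let $T\in\mathbb{R}^{d\times n}$ have rows $T_{1,\bullet},\dots,T_{d,\bullet}$. Suppose there is $\delta>0$ such that $T_{i,\bullet}\mathbf{x}\ge\delta$ for every $i$ and all $\mathbf{x}\in\mathcal{X}$. Let $\mathbf{K}(\mathbf{x})=\{\zeta\in\mathcal{K}:T\mathbf{x}-\zeta\ge 0\}$ (componentwise). Then for $\mathbf{x}\in\mathcal{X}$, $$\mathbb{P}\{\zeta:\zeta\in\mathbf{K}(\mathbf{x})\}=\int_{\mathbb{R}^d}F(\mathbf{x},\xi)\,\tilde p(\xi)\,d\xi=\mathbb{E}_{\tilde p}[F(\mathbf{x},\xi)],$$ where $$F(\mathbf{x},\xi)=\mathcal{C}_{\mathcal{K}}(2\pi)^{d/2}e^{-g(\mathbf{x},\xi)+\|\xi\|_{\mathcal{K}}^2/2},\qquad \tilde p(\xi)=\frac{1}{(2\pi)^{d/2}D_{\mathcal{K}}}e^{-\|\xi\|_{\mathcal{K}}^2/2},$$ $$g(\mathbf{x},\xi)=\max\Big\{\Big(\tfrac{\max(\xi_1,0)}{T_{1,\bullet}\mathbf{x}}\Big)^2,\dots,\Big(\tfrac{\max(\xi_d,0)}{T_{d,\bullet}\mathbf{x}}\Big)^2,\|\xi\|_{\mathcal{K}}^2\Big\},$$ $\mathcal{C}=\frac{1}{\mathrm{Vol}(\mathcal{K})}\frac{1}{\Gamma(1+d/2)}$,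 $D_{\mathcal{K}}>0$ is the scalar for which $\int_{\mathbb{R}^d}\tilde p(\xi)\,d\xi=1$, and $\mathcal{C}_{\mathcal{K}}=\mathcal{C}\,D_{\mathcal{K}}$.
   Context: $\|\zeta\|_{\mathcal{K}}=\inf\{t>0:\zeta/t\in\mathcal{K}\}$ is the Minkowski functional of $\mathcal{K}$. $\mathrm{Vol}$ denotes Lebesgue measure on $\mathbb{R}^d$; since $\zeta$ is uniformly distributed on $\mathcal{K}$, $\mathrm{Vol}(\mathcal{K})>0$. *)

theory Defs
  imports "HOL-Probability.Probability"
begin

definition minkowski_functional :: "'a::real_vector set \<Rightarrow> 'a \<Rightarrow> real" where
  "minkowski_functional K z = Inf {t. t > 0 \<and> z /\<^sub>R t \<in> K}"

(* The order on vectors is componentwise. *)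
definition K_set :: "(real^'d) set \<Rightarrow> real^'n^'d \<Rightarrow> real^'n \<Rightarrow> (real^'d) set" where
  "K_set K T x = {z \<in> K. T *v x - z \<ge> 0}"

definition g_fun :: "(real^'d) set \<Rightarrow> real^'n^'d \<Rightarrow> real^'n \<Rightarrow> real^'d \<Rightarrow> real" where
  "g_fun K T x \<xi> =
     Max (insert ((minkowski_functional K \<xi>)\<^sup>2)
           (range (\<lambda>i. (max (\<xi> $ i) 0 / (row i T \<bullet> x))\<^sup>2)))"

definition gauss_density :: "real \<Rightarrow> (real^'d) set \<Rightarrow> real^'d \<Rightarrow> real" where
  "gauss_density D K \<xi> =
     1 / ((2 * pi) powr (real CARD('d) / 2) * D) * exp (- (minkowski_functional K \<xi>)\<^sup>2 / 2)"

(* The Bochner integral of a non-integrable function is 0, so the equation below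
   also forces integrability. *)
definition D_const :: "(real^'d) set \<Rightarrow> real" where
  "D_const K = (THE D. D > 0 \<and> (\<integral>\<xi>. gauss_density D K \<xi> \<partial>lborel) = 1)"

definition p_tilde :: "(real^'d) set \<Rightarrow> real^'d \<Rightarrow> real" where
  "p_tilde K = gauss_density (D_const K) K"

definition C_const :: "(real^'d) set \<Rightarrow> real" where
  "C_const K = 1 / measure lborel K * (1 / Gamma (1 + real CARD('d) / 2))"

definition C_K_const :: "(real^'d) set \<Rightarrow> real" where
  "C_K_const K = C_const K * D_const K"

definition F_fun :: "(real^'d) set \<Rightarrow> real^'n^'d \<Rightarrow> real^'n \<Rightarrow> real^'d \<Rightarrow> real" where
  "F_fun K T x \<xi> =
     C_K_const K * (2 * pi) powr (real CARD('d) / 2) *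
     exp (- g_fun K T x \<xi> + (minkowski_functional K \<xi>)\<^sup>2 / 2)"

end

theory Submission
  imports Defs
begin

text \<open>
  If the sublevel sets \<open>{q \<le> u}\<close> have volume \<open>V u\<^sup>p\<close>, then integrating
  \<open>exp (- q) = \<integral>\<^sub>q\<^sup>\<infinity> exp (- u) du\<close> and exchanging the integrals
  gives \<open>\<integral> exp (- q) = V \<Gamma> (1 + p)\<close>.  For \<open>p = d / 2\<close> this applies to half the squared
  Minkowski functional of \<open>K\<close>, so that the normalisation \<open>D\<close> exists, and to \<open>g\<close>, whose
  sublevel set at \<open>u\<close> is the feasible set dilated by \<open>\<surd>u\<close>.  In the product of \<open>F\<close> and the
  density the Minkowski functional cancels and a multiple of \<open>exp (- g)\<close> remains.
\<close>

section \<open>Layer-cake integration of \<open>exp (- q)\<close>\<close>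

lemma nn_integral_exp_minus_atLeast:
  "(\<integral>\<^sup>+u. ennreal (exp (- u)) * indicator {a..} u \<partial>lborel) = ennreal (exp (- a))"
proof -
  have "((\<lambda>u::real. - exp (- u)) \<longlongrightarrow> 0) at_top"
    by real_asymp
  then have "(\<integral>\<^sup>+u. ennreal (exp (- u)) * indicator {a..} u \<partial>lborel) = ennreal (0 - (- exp (- a)))"
    by (intro nn_integral_FTC_atLeast[where F = "\<lambda>u. - exp (- u)"])
       (auto intro!: derivative_eq_intros)
  then show ?thesis
    by simp
qed

text \<open>With nonnegative integrals the exchange is Tonelli's theorem and requires no prior
  integrability. Since \<open>V * u powr p\<close> integrates against \<open>exp (- u)\<close> over
  the positive half-line, Euler's integral supplies the Gamma factor.\<close>

lemma (in sigma_finite_measure) nn_integral_exp_minus_layer_cake: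
  fixes q :: "'a \<Rightarrow> real"
  assumes q [measurable]: "q \<in> borel_measurable M"
    and nonneg: "\<And>\<xi>. 0 \<le> q \<xi>"
    and vol: "\<And>u. 0 < u \<Longrightarrow> emeasure M {\<xi> \<in> space M. q \<xi> \<le> u} = ennreal (V * u powr p)"
    and V: "0 \<le> V" and p: "0 \<le> p"
  shows "(\<integral>\<^sup>+\<xi>. ennreal (exp (- q \<xi>)) \<partial>M) = ennreal (V * Gamma (1 + p))"
proof -
  interpret pair_sigma_finite M "lborel :: real measure" ..
  have "(\<integral>\<^sup>+\<xi>. ennreal (exp (- q \<xi>)) \<partial>M)
      = (\<integral>\<^sup>+\<xi>. (\<integral>\<^sup>+u. ennreal (exp (- u)) * indicator {q \<xi>..} u \<partial>lborel) \<partial>M)"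
    by (simp add: nn_integral_exp_minus_atLeast)
  also have "\<dots> = (\<integral>\<^sup>+\<xi>. (\<integral>\<^sup>+u. ennreal (exp (- u)) * indicator {v. q \<xi> \<le> v} u \<partial>lborel) \<partial>M)"
    by (simp add: atLeast_def)
  also have "\<dots> = (\<integral>\<^sup>+u. (\<integral>\<^sup>+\<xi>. ennreal (exp (- u)) * indicator {v. q \<xi> \<le> v} u \<partial>M) \<partial>lborel)"
    by (rule Fubini'[symmetric]) measurable
  \<comment> \<open>The exponent \<open>1 + p - 1\<close> is left unsimplified to match the
    integrand of Gamma at \<open>1 + p\<close>.\<close>
  also have "\<dots> = (\<integral>\<^sup>+u. ennreal V * ennreal (indicator {0..} u * u powr (1 + p - 1) / exp u) \<partial>lborel)"
  \<comment> \<open>The point \<open>u = 0\<close> is discarded as a null set: \<open>vol\<close>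
    says nothing there, and \<open>0 powr p\<close> is \<open>0\<close> even for
    \<open>p = 0\<close>.\<close>
  proof (rule nn_integral_cong_AE)
    have "(\<integral>\<^sup>+\<xi>. ennreal (exp (- u)) * indicator {v. q \<xi> \<le> v} u \<partial>M)
        = ennreal V * ennreal (indicator {0..} u * u powr (1 + p - 1) / exp u)" if "u \<noteq> 0" for u
    proof -
      have "(\<integral>\<^sup>+\<xi>. ennreal (exp (- u)) * indicator {v. q \<xi> \<le> v} u \<partial>M)
          = (\<integral>\<^sup>+\<xi>. ennreal (exp (- u)) * indicator {\<xi> \<in> space M. q \<xi> \<le> u} \<xi> \<partial>M)"
        by (intro nn_integral_cong) (auto simp: indicator_def)
      also have "\<dots> = ennreal (exp (- u)) * emeasure M {\<xi> \<in> space M. q \<xi> \<le> u}"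
        by (simp add: nn_integral_cmult_indicator)
      also have "\<dots> = ennreal V * ennreal (indicator {0..} u * u powr (1 + p - 1) / exp u)"
      proof (cases "0 < u")
        case True
        then show ?thesis
          using V by (simp add: vol ennreal_mult'[symmetric] exp_minus divide_inverse mult_ac)
      next
        case False
        then have "{\<xi> \<in> space M. q \<xi> \<le> u} = {}"
          using nonneg \<open>u \<noteq> 0\<close> by (fastforce dest: order.trans)
        then show ?thesis
          using False \<open>u \<noteq> 0\<close> by (simp only: emeasure_empty) simp
      qed
      finally show ?thesis .
    qed
    then show "AE u in lborel. (\<integral>\<^sup>+\<xi>. ennreal (exp (- u)) * indicator {v. q \<xi> \<le> v} u \<partial>M)
        = ennreal V * ennreal (indicator {0..} u * u powr (1 + p - 1) / exp u)"
      using AE_lborel_singleton[of 0] by (auto elim: eventually_mono)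
  qed
  also have "\<dots> = ennreal V * ennreal (Gamma (1 + p))"
    using p by (simp add: nn_integral_cmult Gamma_conv_nn_integral_real[of "1 + p"])
  finally show ?thesis
    using V by (simp add: ennreal_mult')
qed

lemma (in sigma_finite_measure) integral_exp_minus_layer_cake:
  fixes q :: "'a \<Rightarrow> real"
  assumes "q \<in> borel_measurable M"
    and "\<And>\<xi>. 0 \<le> q \<xi>"
    and "\<And>u. 0 < u \<Longrightarrow> emeasure M {\<xi> \<in> space M. q \<xi> \<le> u} = ennreal (V * u powr p)"
    and "0 \<le> V" and "0 \<le> p"
  shows "(\<integral>\<xi>. exp (- q \<xi>) \<partial>M) = V * Gamma (1 + p)"
proof -
  have "0 \<le> V * Gamma (1 + p)"
    using assms(4,5) by (simp add: Gamma_real_nonneg)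
  then show ?thesis
    using assms(1) nn_integral_exp_minus_layer_cake[OF assms]
    by (subst integral_eq_nn_integral) auto
qed

section \<open>Volumes of dilated sets\<close>

lemma emeasure_lborel_scaleR_image:
  fixes S :: "'a::euclidean_space set"
  assumes "S \<in> sets borel" and "0 < c"
  shows "emeasure lborel ((*\<^sub>R) c ` S) = ennreal (c ^ DIM('a)) * emeasure lborel S"
proof -
  \<comment> \<open>As a preimage under the inverse dilation the image is Borel, so the formula for
    \<open>lebesgue\<close> carries over to \<open>lborel\<close>.\<close>
  have "(*\<^sub>R) c ` S = (*\<^sub>R) (inverse c) -` S"
    using \<open>0 < c\<close> by (auto simp: image_iff intro!: bexI[of _ "inverse c *\<^sub>R _"])
  moreover have "(*\<^sub>R) (inverse c) -` S \<inter> space borel \<in> sets borel"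
    using \<open>S \<in> sets borel\<close> by (intro measurable_sets) auto
  ultimately have "(*\<^sub>R) c ` S \<in> sets borel"
    by simp
  then show ?thesis
    using emeasure_lebesgue_affine[of c 0 S] assms by simp
qed

text \<open>The sublevel set at \<open>u\<close> is \<open>S\<close> dilated by
  \<open>sqrt (a * u)\<close>, so its volume grows like \<open>u\<close> to half the dimension. The
  factor \<open>a\<close> serves two uses: \<open>a = 2\<close> for half the squared Minkowski
  functional, \<open>a = 1\<close> for \<open>g_fun\<close>.\<close>

lemma integral_exp_minus_dilation:
  fixes S :: "'a::euclidean_space set" and q :: "'a \<Rightarrow> real"
  assumes S: "compact S" and a: "0 < a"
    and q: "q \<in> borel_measurable borel" "\<And>\<xi>. 0 \<le> q \<xi>"
    and dilation: "\<And>u \<xi>. 0 < u \<Longrightarrow> q \<xi> \<le> u \<longleftrightarrow> \<xi> /\<^sub>R sqrt (a * u) \<in> S"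
  shows "(\<integral>\<xi>. exp (- q \<xi>) \<partial>lborel)
    = a powr (real DIM('a) / 2) * measure lborel S * Gamma (1 + real DIM('a) / 2)"
proof (rule lborel.integral_exp_minus_layer_cake)
  fix u :: real
  assume u: "0 < u"
  define c where "c = sqrt (a * u)"
  have c: "0 < c"
    using a u by (simp add: c_def)
  have "c ^ DIM('a) = (a * u) powr (real DIM('a) / 2)"
    using a u by (simp add: c_def powr_half_sqrt[symmetric] powr_powr flip: powr_realpow)
  then have pow: "c ^ DIM('a) = a powr (real DIM('a) / 2) * u powr (real DIM('a) / 2)"
    using a u by (simp add: powr_mult)
  have "{\<xi> \<in> space lborel. q \<xi> \<le> u} = (*\<^sub>R) c ` S"
  proof (intro equalityI subsetI)
    fix \<xi>
    assume "\<xi> \<in> {\<xi> \<in> space lborel. q \<xi> \<le> u}"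
    then have "\<xi> /\<^sub>R c \<in> S"
      using dilation[OF u] by (simp add: c_def)
    moreover have "\<xi> = c *\<^sub>R (\<xi> /\<^sub>R c)"
      using c by simp
    ultimately show "\<xi> \<in> (*\<^sub>R) c ` S"
      by blast
  next
    fix \<xi>
    assume "\<xi> \<in> (*\<^sub>R) c ` S"
    then have "\<xi> /\<^sub>R c \<in> S"
      using c by auto
    then show "\<xi> \<in> {\<xi> \<in> space lborel. q \<xi> \<le> u}"
      using dilation[OF u] by (simp add: c_def)
  qed
  then have "emeasure lborel {\<xi> \<in> space lborel. q \<xi> \<le> u} = ennreal (c ^ DIM('a)) * emeasure lborel S"
    using S c by (simp add: emeasure_lborel_scaleR_image borel_compact)
  also have "emeasure lborel S = ennreal (measure lborel S)"
    using emeasure_compact_finite[OF S] by (simp add: emeasure_eq_ennreal_measure)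
  finally show "emeasure lborel {\<xi> \<in> space lborel. q \<xi> \<le> u}
      = ennreal (a powr (real DIM('a) / 2) * measure lborel S * u powr (real DIM('a) / 2))"
    using c by (simp add: pow ennreal_mult'[symmetric] mult_ac)
qed (use q a in auto)

section \<open>Convex bodies and their Minkowski functional\<close>

lemma negligible_iff_emeasure_lborel:
  fixes S :: "'a::euclidean_space set"
  assumes "S \<in> sets borel"
  shows "negligible S \<longleftrightarrow> emeasure lborel S = 0"
  using assms by (subst negligible_iff_emeasure0) simp_all

text \<open>The origin is the midpoint of an interior point \<open>c\<close> and its reflection
  \<open>- c\<close>, and moving from a point of a convex set towards an interior point leads into
  the interior.\<close>

lemma zero_in_interior_symmetric_convex:
  fixes K :: "'a::euclidean_space set"
  assumes "convex K" and "\<And>z. z \<in> K \<Longrightarrow> - z \<in> K" and "interior K \<noteq> {}"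
  shows "0 \<in> interior K"
proof -
  obtain c where c: "c \<in> interior K"
    using assms(3) by blast
  then have "- c \<in> K"
    using assms(2) interior_subset by blast
  then have "- c - (1/2) *\<^sub>R (- c - c) \<in> interior K"
    using mem_interior_convex_shrink[OF assms(1) c] by simp
  moreover have "- c - (1/2) *\<^sub>R (- c - c) = 0"
    by (simp add: algebra_simps flip: scaleR_left.add)
  ultimately show ?thesis
    by simp
qed

locale convex_body =
  fixes K :: "'a::euclidean_space set"
  assumes compact: "compact K" and convex: "convex K" and zero: "0 \<in> interior K"
begin

abbreviation N :: "'a \<Rightarrow> real" where
  "N \<equiv> minkowski_functional K"

text \<open>The point \<open>z /\<^sub>R t\<close> lies on the segment from \<open>0\<close> to
  \<open>z /\<^sub>R s\<close>.\<close>

lemma scale_in_mono: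
  assumes "0 < s" "s \<le> t" "z /\<^sub>R s \<in> K"
  shows "z /\<^sub>R t \<in> K"
proof -
  have "0 \<in> K"
    using zero interior_subset by blast
  then have "(1 - s / t) *\<^sub>R 0 + (s / t) *\<^sub>R (z /\<^sub>R s) \<in> K"
    using assms by (intro convexD[OF convex]) auto
  then show ?thesis
    using assms by (simp add: field_simps)
qed

text \<open>This guards against \<open>Inf {}\<close>, whose value is unspecified.\<close>

lemma scales_nonempty: "{t. t > 0 \<and> z /\<^sub>R t \<in> K} \<noteq> {}"
proof -
  obtain e where e: "0 < e" "cball 0 e \<subseteq> K"
    using zero mem_interior_cball by blast
  \<comment> \<open>The summand \<open>1\<close> keeps \<open>t\<close> positive when
    \<open>z = 0\<close>.\<close>
  define t where "t = norm z / e + 1"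
  have "0 < t" "norm z \<le> e * t"
    using e by (auto simp: t_def field_simps add_pos_nonneg)
  then have "z /\<^sub>R t \<in> cball 0 e"
    by (simp add: field_simps)
  then show ?thesis
    using \<open>0 < t\<close> e by blast
qed

lemma minkowski_nonneg: "0 \<le> N z"
  unfolding minkowski_functional_def by (rule cInf_greatest[OF scales_nonempty]) auto

text \<open>Closedness of \<open>K\<close> makes the boundary case \<open>N z = t\<close> belong to
  the right-hand side. Positivity of \<open>t\<close> matters: \<open>z /\<^sub>R 0\<close> is
  \<open>0\<close>, which lies in \<open>K\<close> for every \<open>z\<close>.\<close>

lemma minkowski_le_iff:
  assumes "0 < t"
  shows "N z \<le> t \<longleftrightarrow> z /\<^sub>R t \<in> K"
proof
  assume le: "N z \<le> t"
  \<comment> \<open>Scales strictly above the infimum are admissible by monotonicity; letting them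
    decrease to \<open>t\<close> stays in the closed set \<open>K\<close>.\<close>
  have "z /\<^sub>R (t + 1 / real (Suc n)) \<in> K" for n
  proof -
    have "Inf {t. t > 0 \<and> z /\<^sub>R t \<in> K} < t + 1 / real (Suc n)"
      using le by (simp add: minkowski_functional_def le_less_trans)
    then obtain s where "s > 0" "z /\<^sub>R s \<in> K" "s < t + 1 / real (Suc n)"
      using cInf_lessD[OF scales_nonempty] by blast
    then show ?thesis
      using scale_in_mono[of s] by simp
  qed
  moreover have "(\<lambda>n. z /\<^sub>R (t + 1 / real (Suc n))) \<longlonglongrightarrow> z /\<^sub>R (t + 0)"
    using \<open>0 < t\<close> by (intro tendsto_intros LIMSEQ_Suc[OF lim_1_over_n]) simp
  ultimately have "z /\<^sub>R (t + 0) \<in> K"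
    by (rule closed_sequentially[OF compact_imp_closed[OF compact]])
  then show "z /\<^sub>R t \<in> K"
    by simp
next
  assume "z /\<^sub>R t \<in> K"
  then show "N z \<le> t"
    unfolding minkowski_functional_def
    using assms by (intro cInf_lower bdd_belowI[of _ 0]) auto
qed

lemma minkowski_measurable [measurable]: "N \<in> borel_measurable borel"
proof (rule borel_measurableI_le)
  have pos: "{z. N z \<le> y} \<in> sets borel" if "0 < y" for y
  proof -
    have "closed ((\<lambda>z. z /\<^sub>R y) -` K)"
      by (intro closed_vimage compact_imp_closed[OF compact] continuous_intros)
    moreover have "{z. N z \<le> y} = (\<lambda>z. z /\<^sub>R y) -` K"
      using minkowski_le_iff[OF that] by auto
    ultimately show ?thesis
      by simp
  qed
  \<comment> \<open>Level \<open>0\<close> is out of reach of \<open>minkowski_le_iff\<close>, so it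
    is written as a countable intersection of positive levels.\<close>
  have zero_eq: "{z. N z \<le> 0} = (\<Inter>n. {z. N z \<le> 1 / real (Suc n)})"
  proof (intro equalityI subsetI)
    fix z assume z: "z \<in> (\<Inter>n. {z. N z \<le> 1 / real (Suc n)})"
    have "N z \<le> 0"
      by (rule LIMSEQ_le_const[OF LIMSEQ_Suc[OF lim_1_over_n]]) (use z in auto)
    then show "z \<in> {z. N z \<le> 0}"
      by simp
  qed (auto intro: order.trans)
  fix y :: real
  consider "y < 0" | "y = 0" | "0 < y"
    by linarith
  then have "{z. N z \<le> y} \<in> sets borel"
  proof cases
    case 1
    then have "{z. N z \<le> y} = {}"
      using minkowski_nonneg by (auto simp: not_le intro: less_le_trans)
    then show ?thesis
      by simp
  next
    case 2
    then show ?thesis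
      unfolding 2 zero_eq by (intro sets.countable_INT) (auto intro: pos)
  qed (rule pos)
  then show "{z \<in> space borel. N z \<le> y} \<in> sets borel"
    by simp
qed

lemma minkowski_square_le_iff:
  assumes "0 < u"
  shows "(N z)\<^sup>2 \<le> u \<longleftrightarrow> z /\<^sub>R sqrt u \<in> K"
proof -
  have "(N z)\<^sup>2 \<le> u \<longleftrightarrow> N z \<le> sqrt u"
    using real_sqrt_le_iff[of "(N z)\<^sup>2" u] minkowski_nonneg[of z] by simp
  then show ?thesis
    using minkowski_le_iff[of "sqrt u" z] assms by simp
qed

lemma integral_exp_minkowski:
  "(\<integral>\<xi>. exp (- (N \<xi>)\<^sup>2 / 2) \<partial>lborel)
     = 2 powr (real DIM('a) / 2) * measure lborel K * Gamma (1 + real DIM('a) / 2)"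
proof -
  have "(N \<xi>)\<^sup>2 / 2 \<le> u \<longleftrightarrow> \<xi> /\<^sub>R sqrt (2 * u) \<in> K" if "0 < u" for u \<xi>
    using minkowski_square_le_iff[of "2 * u" \<xi>] that by (simp add: mult.commute)
  then show ?thesis
    using integral_exp_minus_dilation[OF compact, of 2 "\<lambda>\<xi>. (N \<xi>)\<^sup>2 / 2"] by simp
qed

text \<open>A convex set of measure zero has empty interior.\<close>

lemma measure_pos: "0 < measure lborel K"
proof -
  have "emeasure lborel K \<noteq> 0"
    using zero negligible_convex_interior[OF convex] negligible_iff_emeasure_lborel[of K]
      borel_compact[OF compact] by blast
  then show ?thesis
    using emeasure_compact_finite[OF compact] by (simp add: measure_def enn2real_positive_iff zero_less_iff_neq_zero)
qed

end

section \<open>The normalising constant, \<open>g_fun\<close> and the integrand\<close>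

context
  fixes K :: "(real^'d) set"
  assumes K: "convex_body K"
begin

interpretation convex_body K
  by (rule K)

text \<open>The definite description can be evaluated only once its solution is known to be unique.
  The integral is \<open>I / (P * D)\<close> with \<open>I\<close> and \<open>P\<close> positive,
  which forces \<open>D = I / P\<close>.\<close>

lemma D_const_pos: "0 < D_const K"
proof -
  define I where "I = (\<integral>\<xi>. exp (- (N \<xi>)\<^sup>2 / 2) \<partial>lborel)"
  define P where "P = (2 * pi) powr (real CARD('d) / 2)"
  have I: "0 < I"
    unfolding I_def integral_exp_minkowski using measure_pos by (simp add: Gamma_real_pos)
  have P: "0 < P"
    by (simp add: P_def)
  have int: "(\<integral>\<xi>. gauss_density D K \<xi> \<partial>lborel) = I / (P * D)" for D
    unfolding gauss_density_def I_def P_def by simp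
  have "D > 0 \<and> (\<integral>\<xi>. gauss_density D K \<xi> \<partial>lborel) = 1 \<longleftrightarrow> D = I / P" for D
  proof -
    have "0 < I / P"
      using I P by simp
    moreover have "I / (P * D) = 1 \<longleftrightarrow> D = I / P" if "D > 0"
      using P that by (auto simp: nonzero_divide_eq_eq nonzero_eq_divide_eq mult.commute)
    ultimately show ?thesis
      unfolding int by blast
  qed
  then have "D_const K = I / P"
    unfolding D_const_def by simp
  then show ?thesis
    using I P by simp
qed

lemma p_tilde_measurable [measurable]: "p_tilde K \<in> borel_measurable borel"
  unfolding p_tilde_def gauss_density_def by measurable

lemma p_tilde_nonneg: "0 \<le> p_tilde K \<xi>"
  unfolding p_tilde_def gauss_density_def using D_const_pos by simp

lemma g_fun_le_iff:
  "g_fun K T x \<xi> \<le> u \<longleftrightarrow>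
     (N \<xi>)\<^sup>2 \<le> u \<and> (\<forall>i. (max (\<xi> $ i) 0 / (row i T \<bullet> x))\<^sup>2 \<le> u)"
  unfolding g_fun_def by (subst Max_le_iff) auto

lemma g_fun_nonneg: "0 \<le> g_fun K T x \<xi>"
  unfolding g_fun_def by (rule Max_ge_iff[THEN iffD2]) auto

lemma g_fun_measurable [measurable]: "g_fun K T x \<in> borel_measurable borel"
proof (rule borel_measurableI_le)
  fix y
  have "{\<xi> \<in> space borel. g_fun K T x \<xi> \<le> y} =
      {\<xi> \<in> space borel. (N \<xi>)\<^sup>2 \<le> y} \<inter>
      (\<Inter>i. {\<xi> \<in> space borel. (max (\<xi> $ i) 0 / (row i T \<bullet> x))\<^sup>2 \<le> y})"
    by (auto simp: g_fun_le_iff)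
  also have "\<dots> \<in> sets borel"
  proof (rule sets.Int)
    show "{\<xi> \<in> space borel. (N \<xi>)\<^sup>2 \<le> y} \<in> sets borel"
      by measurable
    have "{\<xi> \<in> space borel. (max (\<xi> $ i) 0 / (row i T \<bullet> x))\<^sup>2 \<le> y} \<in> sets borel" for i
      by measurable
    then show "(\<Inter>i. {\<xi> \<in> space borel. (max (\<xi> $ i) 0 / (row i T \<bullet> x))\<^sup>2 \<le> y}) \<in> sets borel"
      by (intro sets.finite_INT) simp_all
  qed
  finally show "{\<xi> \<in> space borel. g_fun K T x \<xi> \<le> y} \<in> sets borel" .
qed

lemma F_fun_measurable [measurable]: "F_fun K T x \<in> borel_measurable borel"
  unfolding F_fun_def by measurable

text \<open>Each term of the maximum encodes one constraint: the ratios give the rows of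
  \<open>T *v x - z \<ge> 0\<close>, the Minkowski term gives membership in
  \<open>K\<close>.\<close>

lemma g_fun_le_iff_K_set:
  assumes pos: "\<And>i. 0 < row i T \<bullet> x" and u: "0 < u"
  shows "g_fun K T x \<xi> \<le> u \<longleftrightarrow> \<xi> /\<^sub>R sqrt u \<in> K_set K T x"
proof -
  have "(max (\<xi> $ i) 0 / (row i T \<bullet> x))\<^sup>2 \<le> u \<longleftrightarrow> (\<xi> /\<^sub>R sqrt u) $ i \<le> (T *v x) $ i" for i
  proof -
    have "0 \<le> max (\<xi> $ i) 0 / (row i T \<bullet> x)"
      using pos[of i] by (intro divide_nonneg_pos) simp_all
    then have "(max (\<xi> $ i) 0 / (row i T \<bullet> x))\<^sup>2 \<le> u \<longleftrightarrow> max (\<xi> $ i) 0 / (row i T \<bullet> x) \<le> sqrt u"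
      by (metis abs_of_nonneg real_sqrt_abs real_sqrt_le_iff)
    \<comment> \<open>The truncation at \<open>0\<close> disappears because the right-hand side is
      positive.\<close>
    also have "\<dots> \<longleftrightarrow> \<xi> $ i \<le> sqrt u * (row i T \<bullet> x)"
      using pos[of i] u by (simp add: pos_divide_le_eq)
    also have "\<dots> \<longleftrightarrow> \<xi> $ i / sqrt u \<le> row i T \<bullet> x"
      using u by (simp add: pos_divide_le_eq mult.commute)
    also have "\<dots> \<longleftrightarrow> (\<xi> /\<^sub>R sqrt u) $ i \<le> (T *v x) $ i"
      by (simp add: matrix_mult_dot row_def divide_inverse mult.commute)
    finally show ?thesis .
  qed
  then show ?thesis
    using minkowski_square_le_iff[OF u]
    by (simp add: g_fun_le_iff K_set_def less_eq_vec_def)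
qed

lemma compact_K_set: "compact (K_set K T x)"
proof -
  have "K_set K T x = K \<inter> {z. \<forall>i. z $ i \<le> (T *v x) $ i}"
    by (auto simp: K_set_def less_eq_vec_def)
  moreover have "closed {z::real^'d. \<forall>i. z $ i \<le> (T *v x) $ i}"
    by (intro closed_Collect_all closed_Collect_le continuous_intros)
  ultimately show ?thesis
    using compact by (simp add: compact_Int_closed)
qed

lemma F_fun_mult_p_tilde: "F_fun K T x \<xi> * p_tilde K \<xi> = C_const K * exp (- g_fun K T x \<xi>)"
proof -
  have "exp (- g_fun K T x \<xi> + (N \<xi>)\<^sup>2 / 2) * exp (- (N \<xi>)\<^sup>2 / 2) = exp (- g_fun K T x \<xi>)"
    by (simp flip: exp_add)
  then show ?thesis
    using D_const_pos
    by (simp add: F_fun_def p_tilde_def gauss_density_def C_K_const_def field_simps)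
qed

text \<open>The Gamma factor in \<open>C_const\<close> is exactly what cancels the one produced by
  the layer-cake formula, leaving a ratio of volumes.\<close>

lemma integral_F_fun_p_tilde:
  assumes "\<And>i. 0 < row i T \<bullet> x"
  shows "(\<integral>\<xi>. F_fun K T x \<xi> * p_tilde K \<xi> \<partial>lborel)
    = measure lborel (K_set K T x) / measure lborel K"
proof -
  have "(\<integral>\<xi>. exp (- g_fun K T x \<xi>) \<partial>lborel)
      = measure lborel (K_set K T x) * Gamma (1 + real CARD('d) / 2)"
    using integral_exp_minus_dilation[OF compact_K_set, of 1 "g_fun K T x" T x]
      g_fun_le_iff_K_set[OF assms] g_fun_nonneg[of T x] by simp
  moreover have "Gamma (1 + real CARD('d) / 2) \<noteq> 0"
    using Gamma_real_pos[of "1 + real CARD('d) / 2"] by (simp add: add_pos_nonneg less_imp_neq[symmetric])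
  ultimately show ?thesis
    by (simp add: F_fun_mult_p_tilde C_const_def)
qed

end

section \<open>From the uniform law to the probability formula\<close>

lemma convex_body_of_uniform:
  fixes K :: "'b::euclidean_space set"
  assumes "compact K" and "convex K" and "\<And>z. z \<in> K \<Longrightarrow> - z \<in> K"
    and "prob_space (uniform_measure lborel K)"
  shows "convex_body K"
proof
  have "emeasure lborel K / emeasure lborel K = 1"
    using prob_space.emeasure_space_1[OF assms(4)] \<open>compact K\<close> by (simp add: borel_compact)
  \<comment> \<open>In \<open>ennreal\<close> the quotient \<open>0 / 0\<close> is \<open>0\<close>,
    so total mass \<open>1\<close> excludes volume zero.\<close>
  then have "emeasure lborel K \<noteq> 0"
    by (metis ennreal_divide_zero zero_neq_one)
  then have "\<not> negligible K"
    using negligible_iff_emeasure_lborel[OF borel_compact[OF \<open>compact K\<close>]] by simp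
  then show "0 \<in> interior K"
    using zero_in_interior_symmetric_convex[OF assms(2,3)] negligible_convex_interior[OF assms(2)]
    by blast
qed (use assms in auto)

theorem proposition5:
  fixes M :: "'a measure"
    and \<zeta> :: "'a \<Rightarrow> real^'d"
    and K :: "(real^'d) set"
    and X :: "(real^'n) set"
    and T :: "real^'n^'d"
    and \<delta> :: real
    and x :: "real^'n"
  assumes "compact K" and "convex K" and "\<And>z. z \<in> K \<Longrightarrow> - z \<in> K"
    and "prob_space M"
    and "\<zeta> \<in> borel_measurable M"
    and "distr M lborel \<zeta> = uniform_measure lborel K"
    and "closed X" and "convex X" and "bounded X"
    and "\<delta> > 0"
    and "\<And>i y. y \<in> X \<Longrightarrow> row i T \<bullet> y \<ge> \<delta>"
    and "x \<in> X"
  shows "measure M {\<omega> \<in> space M. \<zeta> \<omega> \<in> K_set K T x}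
           = (\<integral>\<xi>. F_fun K T x \<xi> * p_tilde K \<xi> \<partial>lborel) \<and>
         (\<integral>\<xi>. F_fun K T x \<xi> * p_tilde K \<xi> \<partial>lborel)
           = (\<integral>\<xi>. F_fun K T x \<xi> \<partial>(density lborel (\<lambda>\<xi>. ennreal (p_tilde K \<xi>))))"
proof -
  interpret prob_space M
    by fact
  \<comment> \<open>The law of \<open>\<zeta>\<close> is a probability measure, hence so is the
    uniform measure equal to it; this yields the positive volume of \<open>K\<close>.\<close>
  have K: "convex_body K"
    using assms(1-3) prob_space_distr[of \<zeta> lborel] assms(5,6)
    by (intro convex_body_of_uniform) simp_all
  then have pos: "0 < measure lborel K"
    by (rule convex_body.measure_pos)
  have row_pos: "0 < row i T \<bullet> x" for i
    using assms(10) assms(11)[OF assms(12)] by (rule less_le_trans)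
  have S: "K_set K T x \<in> sets borel"
    by (intro borel_compact compact_K_set[OF K])
  have "measure M {\<omega> \<in> space M. \<zeta> \<omega> \<in> K_set K T x} = measure (distr M lborel \<zeta>) (K_set K T x)"
    using assms(5) S by (subst measure_distr) (auto intro!: arg_cong[where f = "measure M"])
  also have "\<dots> = measure lborel (K \<inter> K_set K T x) / measure lborel K"
    unfolding assms(6)
    using pos S emeasure_compact_finite[OF assms(1)]
    by (intro measure_uniform_measure) (auto simp: measure_def)
  also have "K \<inter> K_set K T x = K_set K T x"
    by (auto simp: K_set_def)
  finally have "measure M {\<omega> \<in> space M. \<zeta> \<omega> \<in> K_set K T x}
      = (\<integral>\<xi>. F_fun K T x \<xi> * p_tilde K \<xi> \<partial>lborel)"
    using integral_F_fun_p_tilde[OF K row_pos] by simp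
  \<comment> \<open>Nonnegativity of \<open>p_tilde\<close> ensures that \<open>ennreal\<close> does
    not truncate the density.\<close>
  moreover have "(\<integral>\<xi>. F_fun K T x \<xi> * p_tilde K \<xi> \<partial>lborel)
      = (\<integral>\<xi>. F_fun K T x \<xi> \<partial>(density lborel (\<lambda>\<xi>. ennreal (p_tilde K \<xi>))))"
    using p_tilde_measurable[OF K] p_tilde_nonneg[OF K] F_fun_measurable[OF K]
    by (subst integral_density) (simp_all add: mult.commute)
  ultimately show ?thesis
    by blast
qed

end
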